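(* For all integers $n\geq 1$ and $k\geq 1$, $$F_{n,2}(k)=4F_{n,0}(k)-3F_{n,0}(k-1)-\sum_{i=1}^{n}\binom{n}{i}F_{n-i,0}(k-1).$$
   Context: For an integer $n\ge 0$ let $X_n=\{x_1,\ldots,x_n\}$ be an $n$-element set ($X_0=\emptyset$). For each integer $k\ge 0$ fix an arbitrary choice of $k$ real numbers ("spikes") $0<a_1<a_2<\cdots<a_k<1$, and set $a_0=0$, $a_{k+1}=1$. Consider fuzzy subsets of $X_n$ avoiding the spikes, i.e. maps $\mu:X_n\to[0,1]\setminus\{a_1,\ldots,a_k\}$. Two such fuzzy subsets $\mu,\nu$ are called equivalent ($\mu\sim\nu$) if for all $i=0,1,\ldots,k$ and all $x,y\in X_n$ (with $x=y$ allowed): (i) $\mu(x)=a_{k+1}$ if and only if $\nu(x)=a_{k+1}$; (ii) $a_{i+1}>\mu(x)\geq\mu(y)>a_i$ if and only if $a_{i+1}>\nu(x)\geq\nu(y)>a_i$; (iii) $\mu(x)=a_0$ if and only if $\nu(x)=a_0$. $F_{n,2}(k)$ denotes the number of equivalence classes of $\sim$ on the set of all maps $\mu:X_n\to[0,1]\setminus\{a_1,\ldots,a_k\}$ (both boundary values $0$ and $1$ allowed). $F_{n,0}(k)$ denotes the number of equivalence classes of $\sim$ on the set of all maps $\mu:X_n\to(0,1)\setminus\{a_1,\ldots,a_k\}$ (the values $0$ and $1$ both excluded, so that every membership value lies in one of the $k+1$ open intervals $(a_i,a_{i+1})$, $0\le i\le k$). For $n=0$ there is exactly one (empty) map, so $F_{0,2}(k)=F_{0,0}(k)=1$.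 *)

theory Defs
  imports Complex_Main "HOL-Library.FuncSet"
begin

text \<open>
  The spikes \<open>a 1 < \<dots> < a k\<close> are stored together with the conventional endpoints
  \<open>a 0 = 0\<close> and \<open>a (k + 1) = 1\<close>; values of \<open>a\<close> beyond \<open>k + 1\<close> are irrelevant.
\<close>

definition spikes :: "nat \<Rightarrow> (nat \<Rightarrow> real) \<Rightarrow> bool" where
  "spikes k a \<longleftrightarrow> a 0 = 0 \<and> a (k + 1) = 1 \<and> strict_mono_on {0..k + 1} a"

definition fuzzy_equiv ::
    "'a set \<Rightarrow> nat \<Rightarrow> (nat \<Rightarrow> real) \<Rightarrow> ('a \<Rightarrow> real) \<Rightarrow> ('a \<Rightarrow> real) \<Rightarrow> bool" where
  "fuzzy_equiv X k a \<mu> \<nu> \<longleftrightarrow>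
     (\<forall>i\<in>{0..k}. \<forall>x\<in>X. \<forall>y\<in>X.
        (\<mu> x = a (k + 1) \<longleftrightarrow> \<nu> x = a (k + 1)) \<and>
        ((a (i + 1) > \<mu> x \<and> \<mu> x \<ge> \<mu> y \<and> \<mu> y > a i) \<longleftrightarrow>
         (a (i + 1) > \<nu> x \<and> \<nu> x \<ge> \<nu> y \<and> \<nu> y > a i)) \<and>
        (\<mu> x = a 0 \<longleftrightarrow> \<nu> x = a 0))"

text \<open>
  Maps \<open>X \<rightarrow> V\<close> are extensional functions, so that a map is determined by its values on \<open>X\<close>
  (and there is exactly one map if \<open>X\<close> is empty).
\<close>

definition fuzzy_classes ::
    "'a set \<Rightarrow> real set \<Rightarrow> nat \<Rightarrow> (nat \<Rightarrow> real) \<Rightarrow> ('a \<Rightarrow> real) set set" where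
  "fuzzy_classes X V k a =
     (X \<rightarrow>\<^sub>E V) //
       {(\<mu>, \<nu>). \<mu> \<in> X \<rightarrow>\<^sub>E V \<and> \<nu> \<in> X \<rightarrow>\<^sub>E V \<and> fuzzy_equiv X k a \<mu> \<nu>}"

text \<open>
  \<open>X\<close> is the family of ground sets (\<open>X n\<close> having \<open>n\<close> elements) and \<open>a\<close> the family of
  spike choices (\<open>a k\<close> being a choice of \<open>k\<close> spikes).
\<close>

definition F2 :: "(nat \<Rightarrow> 'a set) \<Rightarrow> (nat \<Rightarrow> nat \<Rightarrow> real) \<Rightarrow> nat \<Rightarrow> nat \<Rightarrow> nat" where
  "F2 X a n k = card (fuzzy_classes (X n) ({0..1} - a k ` {1..k}) k (a k))"

definition F0 :: "(nat \<Rightarrow> 'a set) \<Rightarrow> (nat \<Rightarrow> nat \<Rightarrow> real) \<Rightarrow> nat \<Rightarrow> nat \<Rightarrow> nat" where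
  "F0 X a n k = card (fuzzy_classes (X n) ({0<..<1} - a k ` {1..k}) k (a k))"

end

theory Submission
  imports Defs
begin

text \<open>
  A class of maps is determined by the zero set, the one set and, on the remaining points, a
  family of total preorders, one for each open interval. Let \<open>P X k\<close> be the number of such
  families on \<open>X\<close> with \<open>k + 1\<close> intervals. A nonempty one set \<open>B\<close> can be reread as a
  new top block of the last interval, and those families on \<open>X\<close> with empty last interval are
  counted by \<open>P X (k - 1)\<close>; hence \<open>(\<Sum>B\<subseteq>X. P (X - B) k) = 2 * P X k - P X (k - 1)\<close>. Applying
  this identity once for the one set and once for the zero set gives the formula.
\<close>

section \<open>Fibres of a map and subsets by size\<close>

text \<open>The blocks of the quotient are the fibres of \<open>f\<close> over the values taken on
  \<open>S\<close>, and values with the same nonempty fibre are equal.\<close>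

lemma card_quotient_kernel:
  "card (S // {(x, y). x \<in> S \<and> y \<in> S \<and> f x = f y}) = card (f ` S)"
proof -
  let ?r = "{(x, y). x \<in> S \<and> y \<in> S \<and> f x = f y}"
  let ?fib = "\<lambda>v. {x \<in> S. f x = v}"
  have "?r `` {x} = ?fib (f x)" if "x \<in> S" for x
    using that by auto
  then have "S // ?r = ?fib ` f ` S"
    by (simp add: quotient_def image_image UNION_singleton_eq_range cong: image_cong)
  moreover have "inj_on ?fib (f ` S)"
    by (rule inj_onI) blast
  ultimately show ?thesis
    by (simp add: card_image)
qed

text \<open>Grouping subsets by size turns a sum over zero sets into the binomial sum of the
  theorem.\<close>

lemma sum_Pow_card:
  fixes f :: "nat \<Rightarrow> int"
  assumes "finite X"
  shows "(\<Sum>B\<in>Pow X. f (card B)) = (\<Sum>i=0..card X. int (card X choose i) * f i)"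
proof -
  have "card ` Pow X \<subseteq> {0..card X}"
    using assms by (auto intro: card_mono)
  then have "(\<Sum>B\<in>Pow X. f (card B))
      = (\<Sum>i=0..card X. \<Sum>B\<in>{B \<in> Pow X. card B = i}. f (card B))"
    using assms by (intro sum.group [symmetric]) auto
  also have "\<dots> = (\<Sum>i=0..card X. int (card X choose i) * f i)"
    using n_subsets [OF assms] by (intro sum.cong) (auto simp: Pow_def)
  finally show ?thesis .
qed

section \<open>Families of total preorders indexed by the intervals\<close>

text \<open>
  \<open>(i, x, y) \<in> T\<close> encodes that \<open>x\<close> and \<open>y\<close> have their values in the \<open>i\<close>-th open interval,
  with the value at \<open>x\<close> at least that at \<open>y\<close>.
\<close>

definition patterns :: "'a set \<Rightarrow> nat \<Rightarrow> (nat \<times> 'a \<times> 'a) set set" where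
  "patterns X k = {T. T \<subseteq> {0..k} \<times> X \<times> X \<and>
     (\<forall>x\<in>X. \<exists>!i. (i, x, x) \<in> T) \<and>
     (\<forall>i x y. (i, x, y) \<in> T \<longrightarrow> (i, x, x) \<in> T \<and> (i, y, y) \<in> T) \<and>
     (\<forall>i x y z. (i, x, y) \<in> T \<longrightarrow> (i, y, z) \<in> T \<longrightarrow> (i, x, z) \<in> T) \<and>
     (\<forall>i x y. (i, x, x) \<in> T \<longrightarrow> (i, y, y) \<in> T \<longrightarrow> (i, x, y) \<in> T \<or> (i, y, x) \<in> T)}"

lemma patternsI:
  assumes "\<And>i x y. (i, x, y) \<in> T \<Longrightarrow> i \<le> k \<and> x \<in> X \<and> y \<in> X"
    and "\<And>x. x \<in> X \<Longrightarrow> \<exists>i. (i, x, x) \<in> T"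
    and "\<And>i j x. (i, x, x) \<in> T \<Longrightarrow> (j, x, x) \<in> T \<Longrightarrow> i = j"
    and "\<And>i x y. (i, x, y) \<in> T \<Longrightarrow> (i, x, x) \<in> T \<and> (i, y, y) \<in> T"
    and "\<And>i x y z. (i, x, y) \<in> T \<Longrightarrow> (i, y, z) \<in> T \<Longrightarrow> (i, x, z) \<in> T"
    and "\<And>i x y. (i, x, x) \<in> T \<Longrightarrow> (i, y, y) \<in> T \<Longrightarrow> (i, x, y) \<in> T \<or> (i, y, x) \<in> T"
  shows "T \<in> patterns X k"
  unfolding patterns_def
proof (intro CollectI conjI ballI allI impI)
  show "T \<subseteq> {0..k} \<times> X \<times> X"
    by (auto dest: assms(1))
  show "\<exists>!i. (i, x, x) \<in> T" if "x \<in> X" for x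
    using assms(2) [OF that] assms(3) by blast
qed (use assms(4-6) in blast)+

lemma
  assumes "T \<in> patterns X k"
  shows patterns_carrier: "(i, x, y) \<in> T \<Longrightarrow> i \<le> k \<and> x \<in> X \<and> y \<in> X"
    and patterns_ex: "x \<in> X \<Longrightarrow> \<exists>i. (i, x, x) \<in> T"
    and patterns_unique: "(i, x, x) \<in> T \<Longrightarrow> (j, x, x) \<in> T \<Longrightarrow> i = j"
    and patterns_field: "(i, x, y) \<in> T \<Longrightarrow> (i, x, x) \<in> T \<and> (i, y, y) \<in> T"
    and patterns_trans: "(i, x, y) \<in> T \<Longrightarrow> (i, y, z) \<in> T \<Longrightarrow> (i, x, z) \<in> T"
    and patterns_total: "(i, x, x) \<in> T \<Longrightarrow> (i, y, y) \<in> T \<Longrightarrow> (i, x, y) \<in> T \<or> (i, y, x) \<in> T"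
proof -
  note T = assms [unfolded patterns_def mem_Collect_eq]
  note T1 = T [THEN conjunct1] and T2 = T [THEN conjunct2, THEN conjunct1]
  note T3 = T [THEN conjunct2, THEN conjunct2]
  show carr: "(i, x, y) \<in> T \<Longrightarrow> i \<le> k \<and> x \<in> X \<and> y \<in> X" for i x y
    using subsetD [OF T1, of "(i, x, y)"] by simp
  show "x \<in> X \<Longrightarrow> \<exists>i. (i, x, x) \<in> T"
    using T2 by blast
  show "(i, x, x) \<in> T \<Longrightarrow> (j, x, x) \<in> T \<Longrightarrow> i = j"
    using T2 carr by blast
  show "(i, x, y) \<in> T \<Longrightarrow> (i, x, x) \<in> T \<and> (i, y, y) \<in> T"
    by (rule T3 [THEN conjunct1, rule_format])
  show "(i, x, y) \<in> T \<Longrightarrow> (i, y, z) \<in> T \<Longrightarrow> (i, x, z) \<in> T"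
    by (rule T3 [THEN conjunct2, THEN conjunct1, rule_format])
  show "(i, x, x) \<in> T \<Longrightarrow> (i, y, y) \<in> T \<Longrightarrow> (i, x, y) \<in> T \<or> (i, y, x) \<in> T"
    by (rule T3 [THEN conjunct2, THEN conjunct2, rule_format])
qed

lemma patterns_subset_Pow: "patterns X k \<subseteq> Pow ({0..k} \<times> X \<times> X)"
  by (rule subsetI) (simp add: patterns_def)

lemma finite_patterns:
  assumes "finite X"
  shows "finite (patterns X k)"
  using patterns_subset_Pow by (rule finite_subset) (simp add: assms)

text \<open>Relabelling the points along \<open>h\<close> is injective on patterns. An inequality
  suffices, since the inverse bijection yields the other one.\<close>

lemma card_patterns_le:
  fixes X :: "'a set" and Y :: "'b set"
  assumes "finite Y" and h: "bij_betw h X Y"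
  shows "card (patterns X k) \<le> card (patterns Y k)"
proof (rule card_inj_on_le)
  let ?h = "map_prod id (map_prod h h) :: nat \<times> 'a \<times> 'a \<Rightarrow> nat \<times> 'b \<times> 'b"
  have inj: "inj_on h X" and img: "h ` X = Y"
    using h by (auto simp: bij_betw_def)
  have "inj_on ?h ({0..k} \<times> X \<times> X)"
    using inj by (auto simp: inj_on_def)
  then have "inj_on ((`) ?h) (Pow ({0..k} \<times> X \<times> X))"
    by (rule inj_on_image_Pow)
  then show "inj_on ((`) ?h) (patterns X k)"
    using patterns_subset_Pow by (rule inj_on_subset)
  show "(`) ?h ` patterns X k \<subseteq> patterns Y k"
  proof safe
    fix T assume T: "T \<in> patterns X k"
    define g where "g = inv_into X h"
    have g: "g (h x) = x" if "x \<in> X" for x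
      using that inj by (simp add: g_def)
    have hg: "h (g u) = u" "g u \<in> X" if "u \<in> Y" for u
      using that img by (auto simp: g_def f_inv_into_f inv_into_into)
    \<comment> \<open>Pulling membership back along \<open>g\<close> reduces each axiom for the
      image to the same axiom for \<open>T\<close>.\<close>
    have mem: "(i, u, v) \<in> ?h ` T \<longleftrightarrow> u \<in> Y \<and> v \<in> Y \<and> (i, g u, g v) \<in> T" for i u v
    proof
      assume "(i, u, v) \<in> ?h ` T"
      then obtain x y where "(i, x, y) \<in> T" "u = h x" "v = h y"
        by auto
      with g patterns_carrier [OF T] img show "u \<in> Y \<and> v \<in> Y \<and> (i, g u, g v) \<in> T"
        by (metis imageI)
    next
      assume "u \<in> Y \<and> v \<in> Y \<and> (i, g u, g v) \<in> T"
      then show "(i, u, v) \<in> ?h ` T"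
        by (intro image_eqI [of _ _ "(i, g u, g v)"]) (simp_all add: hg)
    qed
    show "?h ` T \<in> patterns Y k"
    proof (rule patternsI, goal_cases)
      case (1 i u v)
      then show ?case using patterns_carrier [OF T] unfolding mem by blast
    next
      case (2 u)
      then show ?case using patterns_ex [OF T, of "g u"] hg unfolding mem by blast
    next
      case (3 i j u)
      then show ?case using patterns_unique [OF T, of i "g u" j] unfolding mem by blast
    next
      case (4 i u v)
      then show ?case using patterns_field [OF T, of i "g u" "g v"] unfolding mem by blast
    next
      case (5 i u v w)
      then show ?case using patterns_trans [OF T, of i "g u" "g v" "g w"] unfolding mem by blast
    next
      case (6 i u v)
      then show ?case using patterns_total [OF T, of i "g u" "g v"] unfolding mem by blast
    qed
  qed
  show "finite (patterns Y k)"
    by (rule finite_patterns [OF \<open>finite Y\<close>])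
qed

lemma card_patterns_cong:
  assumes "finite X" "finite Y" "card X = card Y"
  shows "card (patterns X k) = card (patterns Y k)"
proof -
  obtain h where "bij_betw h X Y"
    using assms finite_same_card_bij by blast
  with assms show ?thesis
    by (meson antisym bij_betw_inv_into card_patterns_le)
qed

text \<open>Among the axioms only the bound on the indices involves \<open>k\<close>, so any bound
  valid for \<open>T\<close> may replace it, be it smaller or larger.\<close>

lemma patterns_restrict_index:
  assumes T: "T \<in> patterns X k" and "\<And>i x y. (i, x, y) \<in> T \<Longrightarrow> i \<le> l"
  shows "T \<in> patterns X l"
proof (rule patternsI)
  show "i \<le> l \<and> x \<in> X \<and> y \<in> X" if "(i, x, y) \<in> T" for i x y
    using patterns_carrier [OF T that] assms(2) [OF that] by blast
qed (rule patterns_ex [OF T] patterns_unique [OF T] patterns_field [OF T]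
  patterns_trans [OF T] patterns_total [OF T]; assumption)+

text \<open>By \<open>patterns_field\<close>, an empty last interval means that no triple has index
  \<open>Suc k\<close>. The number of intervals leaves no other trace in a pattern, so the two sets
  are literally equal.\<close>

lemma patterns_top_empty:
  "{T \<in> patterns X (Suc k). \<forall>x. (Suc k, x, x) \<notin> T} = patterns X k"
proof (intro set_eqI iffI)
  fix T assume "T \<in> {T \<in> patterns X (Suc k). \<forall>x. (Suc k, x, x) \<notin> T}"
  then have T: "T \<in> patterns X (Suc k)" and top: "(Suc k, x, x) \<notin> T" for x
    by simp_all
  show "T \<in> patterns X k"
  proof (rule patterns_restrict_index [OF T])
    fix i x y assume t: "(i, x, y) \<in> T"
    then have "i \<noteq> Suc k"
      using top patterns_field [OF T t] by blast
    then show "i \<le> k"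
      using patterns_carrier [OF T t] by simp
  qed
next
  fix T assume T: "T \<in> patterns X k"
  then have "T \<in> patterns X (Suc k)"
    by (rule patterns_restrict_index) (auto dest: patterns_carrier [OF T])
  moreover have "(Suc k, x, x) \<notin> T" for x
    using patterns_carrier [OF T, of "Suc k" x x] by auto
  ultimately show "T \<in> {T \<in> patterns X (Suc k). \<forall>x. (Suc k, x, x) \<notin> T}"
    by simp
qed

section \<open>Splitting off the top block of the last interval\<close>

text \<open>
  Separating the block of largest elements from the top interval: a nonempty set \<open>B\<close> can be
  put on top of the interval \<open>k\<close> in exactly one way.
\<close>

lemma card_patterns_top_nonempty:
  assumes "finite X"
  shows "card {T \<in> patterns X k. \<exists>x. (k, x, x) \<in> T}
    = (\<Sum>B\<in>Pow X - {{}}. card (patterns (X - B) k))"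
proof -
  \<comment> \<open>\<open>top T\<close> is the block of largest elements of interval
    \<open>k\<close>, \<open>cut\<close> deletes every triple that meets \<open>B\<close>, and
    \<open>put\<close> adds \<open>B\<close> as one block of equivalent elements above interval
    \<open>k\<close>.\<close>
  define top where "top T = {x. (k, x, x) \<in> T \<and> (\<forall>y. (k, y, y) \<in> T \<longrightarrow> (k, x, y) \<in> T)}"
    for T :: "(nat \<times> 'a \<times> 'a) set"
  define cut where "cut B T = {(i, x, y). (i, x, y) \<in> T \<and> x \<notin> B \<and> y \<notin> B}"
    for B and T :: "(nat \<times> 'a \<times> 'a) set"
  define put where
    "put B T = T \<union> {(i, x, y). i = k \<and> x \<in> B \<and> (y \<in> B \<or> (k, y, y) \<in> T)}"
    for B and T :: "(nat \<times> 'a \<times> 'a) set"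
  let ?N = "{T \<in> patterns X k. \<exists>x. (k, x, x) \<in> T}"
  let ?S = "SIGMA B:Pow X - {{}}. patterns (X - B) k"
  have cut: "cut B T \<in> patterns (X - B) k" if T: "T \<in> patterns X k" for B T
  proof (rule patternsI, goal_cases)
    case (1 i x y)
    then show ?case using patterns_carrier [OF T, of i x y] by (simp add: cut_def)
  next
    case (2 x)
    then show ?case using patterns_ex [OF T, of x] by (simp add: cut_def)
  next
    case (3 i j x)
    then show ?case using patterns_unique [OF T, of i x j] by (simp add: cut_def)
  next
    case (4 i x y)
    then show ?case using patterns_field [OF T, of i x y] by (simp add: cut_def)
  next
    case (5 i x y z)
    then show ?case using patterns_trans [OF T, of i x y z] by (simp add: cut_def)
  next
    case (6 i x y)
    then show ?case using patterns_total [OF T, of i x y] by (simp add: cut_def)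
  qed
  have put: "put B T \<in> patterns X k" and top: "top (put B T) = B" and cutput: "cut B (put B T) = T"
    if B: "B \<subseteq> X" "B \<noteq> {}" and T: "T \<in> patterns (X - B) k" for B T
  proof -
    have out: "x \<notin> B \<and> y \<notin> B" if "(i, x, y) \<in> T" for i x y
      using that patterns_carrier [OF T] by blast
    have mem: "(i, x, y) \<in> put B T \<longleftrightarrow>
        (i, x, y) \<in> T \<or> i = k \<and> x \<in> B \<and> (y \<in> B \<or> (k, y, y) \<in> T)" for i x y
      by (simp add: put_def)
    show "put B T \<in> patterns X k"
    proof (rule patternsI, goal_cases)
      case (1 i x y)
      then show ?case using patterns_carrier [OF T] B unfolding mem by blast
    next
      case (2 x)
      then show ?case using patterns_ex [OF T, of x] unfolding mem by blast
    next
      case (3 i j x)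
      then show ?case using patterns_unique [OF T, of i x j] out unfolding mem by blast
    next
      case (4 i x y)
      then show ?case using patterns_field [OF T, of i x y] unfolding mem by blast
    next
      \<comment> \<open>An added triple followed by one of \<open>T\<close> composes to an added
        one, by \<open>patterns_field\<close>; the opposite order cannot occur, by
        \<open>out\<close>.\<close>
      case (5 i x y z)
      then show ?case
        using patterns_trans [OF T, of i x y z] patterns_field [OF T, of i y z] out
        unfolding mem by blast
    next
      case (6 i x y)
      then show ?case using patterns_total [OF T, of i x y] unfolding mem by blast
    qed
    \<comment> \<open>Here \<open>B\<close> must be nonempty: a largest element is above some member
      of \<open>B\<close>, and by \<open>out\<close> only members of \<open>B\<close> are.\<close>
    show "top (put B T) = B"
      using B out unfolding top_def put_def by blast
    show "cut B (put B T) = T"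
      using out unfolding cut_def put_def by blast
  qed
  have ne: "top T \<noteq> {}" "top T \<subseteq> X" if T: "T \<in> patterns X k" and x: "(k, x, x) \<in> T" for T x
  proof -
    let ?K = "{x. (k, x, x) \<in> T}"
    have K: "?K \<subseteq> X"
      using patterns_carrier [OF T] by blast
    then show "top T \<subseteq> X"
      by (auto simp: top_def)
    have "finite ?K"
      using K assms finite_subset by blast
    \<comment> \<open>A finite nonempty part of a total preorder has a largest element: a maximum
      \<open>m\<close> of \<open>L\<close> is compared with the new point \<open>z\<close>.\<close>
    moreover have "L \<noteq> {} \<Longrightarrow> \<exists>m\<in>L. \<forall>y\<in>L. (k, m, y) \<in> T" if "finite L" "L \<subseteq> ?K" for L
      using that
    proof (induction L rule: finite_induct)
      case (insert z L)
      show ?case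
      proof (cases "L = {}")
        case True
        then show ?thesis using insert.prems by auto
      next
        case False
        then obtain m where m: "m \<in> L" "\<forall>y\<in>L. (k, m, y) \<in> T"
          using insert by auto
        have "(k, m, z) \<in> T \<or> (k, z, m) \<in> T"
          using m insert.prems patterns_total [OF T] by blast
        then show ?thesis
          using m insert.prems patterns_trans [OF T] by blast
      qed
    qed simp
    ultimately have "\<exists>m\<in>?K. \<forall>y\<in>?K. (k, m, y) \<in> T"
      using x by blast
    then show "top T \<noteq> {}"
      by (auto simp: top_def)
  qed
  have putcut: "put (top T) (cut (top T) T) = T" if T: "T \<in> patterns X k" for T
  proof -
    \<comment> \<open>Only members of the top block lie above a member of it, and members lie only
      above points of interval \<open>k\<close>. So \<open>put\<close> restores exactly the triples
      deleted by \<open>cut\<close>.\<close>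
    have low: "(i, y, x) \<in> T \<Longrightarrow> x \<in> top T \<Longrightarrow> i = k \<and> y \<in> top T" for i x y
      using patterns_field [OF T] patterns_unique [OF T] patterns_trans [OF T]
      unfolding top_def by blast
    have high: "(i, x, y) \<in> T \<Longrightarrow> x \<in> top T \<Longrightarrow> i = k \<and> (k, y, y) \<in> T" for i x y
      using patterns_field [OF T] patterns_unique [OF T]
      unfolding top_def by blast
    have mem: "(k, x, y) \<in> T" if "x \<in> top T" "(k, y, y) \<in> T" for x y
      using that unfolding top_def by blast
    have diag: "(k, x, x) \<in> T" if "x \<in> top T" for x
      using that unfolding top_def by blast
    show ?thesis
      unfolding put_def cut_def using low high mem diag by blast
  qed
  have "bij_betw (\<lambda>T. (top T, cut (top T) T)) ?N ?S"
  proof (rule bij_betw_byWitness [where f' = "\<lambda>(B, T). put B T"])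
    show "\<forall>T\<in>?N. (case (top T, cut (top T) T) of (B, T) \<Rightarrow> put B T) = T"
      using putcut by auto
    show "\<forall>p\<in>?S. (top (case p of (B, T) \<Rightarrow> put B T),
        cut (top (case p of (B, T) \<Rightarrow> put B T)) (case p of (B, T) \<Rightarrow> put B T)) = p"
      using top cutput by auto
    show "(\<lambda>T. (top T, cut (top T) T)) ` ?N \<subseteq> ?S"
      using ne cut by blast
    show "(\<lambda>(B, T). put B T) ` ?S \<subseteq> ?N"
    proof safe
      fix B T x assume B: "B \<subseteq> X" "x \<in> B" and T: "T \<in> patterns (X - B) k"
      then show "put B T \<in> patterns X k"
        using put by blast
      show "\<exists>x. (k, x, x) \<in> put B T"
        using B by (auto simp: put_def)
    qed
  qed
  then have "card ?N = card ?S"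
    by (rule bij_betw_same_card)
  also have "\<dots> = (\<Sum>B\<in>Pow X - {{}}. card (patterns (X - B) k))"
    using assms by (subst card_SigmaI) (auto intro: finite_patterns)
  finally show ?thesis .
qed

text \<open>The term \<open>B = {}\<close> counts all patterns. The nonempty \<open>B\<close>, read
  as top blocks, count those with a nonempty last interval, that is, all but the patterns with one
  interval fewer.\<close>

lemma sum_patterns_Diff:
  assumes "finite X"
  shows "(\<Sum>B\<in>Pow X. int (card (patterns (X - B) (Suc k))))
    = 2 * int (card (patterns X (Suc k))) - int (card (patterns X k))"
proof -
  let ?P = "patterns X (Suc k)"
  let ?N = "{T \<in> ?P. \<exists>x. (Suc k, x, x) \<in> T}"
  have "card ?P = card (patterns X k) + card ?N"
  proof -
    have "?P = patterns X k \<union> ?N" "patterns X k \<inter> ?N = {}"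
      unfolding patterns_top_empty [of X k, symmetric] by auto
    then show ?thesis
      using finite_patterns [OF assms] by (metis (lifting) card_Un_disjoint finite_Un)
  qed
  moreover have "(\<Sum>B\<in>Pow X. card (patterns (X - B) (Suc k))) = card ?P + card ?N"
    unfolding card_patterns_top_nonempty [OF assms]
    using assms by (subst sum.remove [of _ "{}"]) auto
  ultimately show ?thesis
    unfolding of_nat_sum [symmetric] by simp
qed

section \<open>Invariants that characterise a class of fuzzy subsets\<close>

definition zeros :: "'a set \<Rightarrow> ('a \<Rightarrow> real) \<Rightarrow> 'a set" where
  "zeros X \<mu> = {x \<in> X. \<mu> x = 0}"

definition ones :: "'a set \<Rightarrow> ('a \<Rightarrow> real) \<Rightarrow> 'a set" where
  "ones X \<mu> = {x \<in> X. \<mu> x = 1}"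

definition pattern ::
    "'a set \<Rightarrow> nat \<Rightarrow> (nat \<Rightarrow> real) \<Rightarrow> ('a \<Rightarrow> real) \<Rightarrow> (nat \<times> 'a \<times> 'a) set" where
  "pattern X k a \<mu> = {(i, x, y). i \<le> k \<and> x \<in> X \<and> y \<in> X \<and>
     a (i + 1) > \<mu> x \<and> \<mu> x \<ge> \<mu> y \<and> \<mu> y > a i}"

text \<open>Equivalence becomes the kernel of a map into triples, so that
  \<open>card_quotient_kernel\<close> counts classes as values of this map.\<close>

lemma fuzzy_equiv_iff:
  assumes "spikes k a"
  shows "fuzzy_equiv X k a \<mu> \<nu> \<longleftrightarrow>
    (zeros X \<mu>, ones X \<mu>, pattern X k a \<mu>) = (zeros X \<nu>, ones X \<nu>, pattern X k a \<nu>)"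
proof -
  have a: "a 0 = 0" "a (k + 1) = 1"
    using assms by (auto simp: spikes_def)
  define R where "R \<xi> i x y \<longleftrightarrow> a (i + 1) > \<xi> x \<and> \<xi> x \<ge> \<xi> y \<and> \<xi> y > a i"
    for \<xi> :: "'a \<Rightarrow> real" and i x y
  have mem: "(i, x, y) \<in> pattern X k a \<xi> \<longleftrightarrow> i \<in> {0..k} \<and> x \<in> X \<and> y \<in> X \<and> R \<xi> i x y"
    for \<xi> i x y
    by (simp add: pattern_def R_def)
  have "pattern X k a \<mu> = pattern X k a \<nu> \<longleftrightarrow>
      (\<forall>i\<in>{0..k}. \<forall>x\<in>X. \<forall>y\<in>X. R \<mu> i x y \<longleftrightarrow> R \<nu> i x y)" (is "?l \<longleftrightarrow> ?r")
  proof
    assume ?l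
    then show ?r
      using mem [of _ _ _ \<mu>] mem [of _ _ _ \<nu>] by (intro ballI) metis
  next
    assume ?r
    show ?l
    proof (intro set_eqI)
      fix p :: "nat \<times> 'a \<times> 'a"
      obtain i x y where p: "p = (i, x, y)"
        by (cases p)
      show "p \<in> pattern X k a \<mu> \<longleftrightarrow> p \<in> pattern X k a \<nu>"
        unfolding p mem using \<open>?r\<close> by blast
    qed
  qed
  moreover have "zeros X \<mu> = zeros X \<nu> \<longleftrightarrow> (\<forall>x\<in>X. \<mu> x = 0 \<longleftrightarrow> \<nu> x = 0)"
    "ones X \<mu> = ones X \<nu> \<longleftrightarrow> (\<forall>x\<in>X. \<mu> x = 1 \<longleftrightarrow> \<nu> x = 1)"
    unfolding zeros_def ones_def by blast+
  moreover have "fuzzy_equiv X k a \<mu> \<nu> \<longleftrightarrow> (\<forall>x\<in>X. \<mu> x = 1 \<longleftrightarrow> \<nu> x = 1) \<and>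
      (\<forall>i\<in>{0..k}. \<forall>x\<in>X. \<forall>y\<in>X. R \<mu> i x y \<longleftrightarrow> R \<nu> i x y) \<and>
      (\<forall>x\<in>X. \<mu> x = 0 \<longleftrightarrow> \<nu> x = 0)"
    \<comment> \<open>The clauses for the values 1 and 0 stand under the quantifier over
      \<open>i\<close>; as 0 always lies in its range, the instance \<open>i = 0\<close> frees
      them.\<close>
    unfolding fuzzy_equiv_def a R_def [symmetric] ball_conj_distrib
    by (rule iffI) (auto dest: bspec [of _ _ 0])
  ultimately show ?thesis
    unfolding prod.inject by argo
qed

lemma card_fuzzy_classes:
  assumes "spikes k a"
  shows "card (fuzzy_classes X V k a)
    = card ((\<lambda>\<mu>. (zeros X \<mu>, ones X \<mu>, pattern X k a \<mu>)) ` (X \<rightarrow>\<^sub>E V))"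
  unfolding fuzzy_classes_def fuzzy_equiv_iff [OF assms] by (rule card_quotient_kernel)

section \<open>Position of a value among the spikes\<close>

lemma spikes_less:
  assumes "spikes k a" "i < j" "j \<le> k + 1"
  shows "a i < a j"
  using assms by (auto simp: spikes_def strict_mono_on_def)

lemma spikes_le:
  assumes "spikes k a" "i \<le> j" "j \<le> k + 1"
  shows "a i \<le> a j"
  using assms spikes_less [of k a i j] by (cases "i = j") auto

lemma spikes_interval_unique:
  assumes a: "spikes k a" and "i \<le> k" "j \<le> k"
    and "a i < v" "v < a (i + 1)" "a j < v" "v < a (j + 1)"
  shows "i = j"
  using assms spikes_le [OF a, of "i + 1" j] spikes_le [OF a, of "j + 1" i]
  by (cases i j rule: linorder_cases) auto

lemma spikes_interval_ex:
  assumes a: "spikes k a" and v: "0 < v" "v < 1" "v \<notin> a ` {1..k}"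
  shows "\<exists>i\<le>k. a i < v \<and> v < a (i + 1)"
proof -
  have ends: "a 0 = 0" "a (k + 1) = 1"
    using a by (auto simp: spikes_def)
  \<comment> \<open>The least index exists and is at most \<open>k + 1\<close> because
    \<open>v < 1 = a (k + 1)\<close>; it is positive because \<open>a 0 = 0 < v\<close>. Its
    predecessor bounds \<open>v\<close> from below, strictly since \<open>v\<close> is neither 0 nor
    a spike.\<close>
  define j where "j = (LEAST j. v < a j)"
  have j: "v < a j" and "j \<le> k + 1"
    unfolding j_def using v ends LeastI [of "\<lambda>j. v < a j" "k + 1"]
      Least_le [of "\<lambda>j. v < a j" "k + 1"] by auto
  have "j \<noteq> 0"
    using j ends v by (intro notI) auto
  then obtain i where i: "j = Suc i"
    by (cases j) auto
  have "\<not> v < a i"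
    using i not_less_Least [of i "\<lambda>j. v < a j"] by (simp add: j_def)
  moreover have "a i \<noteq> v"
    using v ends \<open>j \<le> k + 1\<close> i by (cases "i = 0") auto
  ultimately show ?thesis
    using i j \<open>j \<le> k + 1\<close> by (intro exI [of _ i]) auto
qed

section \<open>Maps realise exactly the patterns\<close>

text \<open>All endpoints lie between 0 and 1, so points of value 0 or 1 lie in no open interval;
  every other point lies in exactly one. The order axioms are inherited from the reals.\<close>

lemma pattern_in_patterns:
  assumes a: "spikes k a" and \<mu>: "\<mu> \<in> X \<rightarrow>\<^sub>E {0..1} - a ` {1..k}"
  shows "pattern X k a \<mu> \<in> patterns (X - zeros X \<mu> - ones X \<mu>) k"
proof (rule patternsI)
  have ge: "0 \<le> a i" if "i \<le> k" for i
    using spikes_le [OF a, of 0 i] that a by (auto simp: spikes_def)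
  have le: "a (i + 1) \<le> 1" if "i \<le> k" for i
    using spikes_le [OF a, of "i + 1" "k + 1"] that a by (auto simp: spikes_def)
  show "i \<le> k \<and> x \<in> X - zeros X \<mu> - ones X \<mu> \<and> y \<in> X - zeros X \<mu> - ones X \<mu>"
    if "(i, x, y) \<in> pattern X k a \<mu>" for i x y
    using that ge [of i] le [of i] by (auto simp: pattern_def zeros_def ones_def)
  show "\<exists>i. (i, x, x) \<in> pattern X k a \<mu>" if "x \<in> X - zeros X \<mu> - ones X \<mu>" for x
  proof -
    have "\<mu> x \<in> {0..1} - a ` {1..k}"
      using that \<mu> by auto
    then show ?thesis
      using that spikes_interval_ex [OF a, of "\<mu> x"] by (force simp: pattern_def zeros_def ones_def)
  qed
  show "i = j" if "(i, x, x) \<in> pattern X k a \<mu>" "(j, x, x) \<in> pattern X k a \<mu>" for i j x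
    using that spikes_interval_unique [OF a, of i j "\<mu> x"] by (auto simp: pattern_def)
qed (auto simp: pattern_def)

text \<open>
  The witness sends \<open>x\<close> to the point of its interval whose relative position is the number of
  elements not above \<open>x\<close>, divided by \<open>card X + 1\<close>.
\<close>

lemma pattern_realized:
  assumes a: "spikes k a" and "finite X" and Z: "Z \<subseteq> X" and B: "B \<subseteq> X - Z"
    and T: "T \<in> patterns (X - Z - B) k"
  shows "\<exists>\<mu> \<in> X \<rightarrow>\<^sub>E {0..1} - a ` {1..k}.
    zeros X \<mu> = Z \<and> ones X \<mu> = B \<and> pattern X k a \<mu> = T"
proof -
  let ?Y = "X - Z - B"
  define D where "D i x = {y. (i, x, y) \<in> T}" for i x
  \<comment> \<open>The added 1 keeps the quotient below 1; it is positive because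
    \<open>D i x\<close> contains \<open>x\<close> when \<open>x\<close> lies in interval
    \<open>i\<close>.\<close>
  define pos where "pos i x = real (card (D i x)) / (real (card X) + 1)" for i x
  define val where "val i x = a i + (a (i + 1) - a i) * pos i x" for i x
  define idx where "idx x = (THE i. (i, x, x) \<in> T)" for x
  \<comment> \<open>The value \<open>undefined\<close> off \<open>X\<close> makes the map
    extensional.\<close>
  define \<mu> where "\<mu> x = (if x \<in> Z then 0 else if x \<in> B then 1
    else if x \<in> X then val (idx x) x else undefined)" for x
  have ends: "a 0 = 0" "a (k + 1) = 1"
    using a by (auto simp: spikes_def)
  have gap: "a i < a (i + 1)" "0 \<le> a i" "a (i + 1) \<le> 1" if "i \<le> k" for i
    using spikes_less [OF a, of i "i + 1"] spikes_le [OF a, of 0 i]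
      spikes_le [OF a, of "i + 1" "k + 1"] that ends by auto
  have DX: "D i x \<subseteq> X" for i x
    using patterns_carrier [OF T] by (auto simp: D_def)
  then have Dfin: "finite (D i x)" for i x
    using \<open>finite X\<close> finite_subset by blast
  have idx: "idx x = i" if "(i, x, x) \<in> T" for i x
    unfolding idx_def using that patterns_unique [OF T] by blast
  have \<mu>_val: "\<mu> x = val i x" and ik: "i \<le> k" and xY: "x \<in> ?Y" if "(i, x, x) \<in> T" for i x
    using that idx [OF that] patterns_carrier [OF T that] by (auto simp: \<mu>_def)
  have bounds: "a i < \<mu> x" "\<mu> x < a (i + 1)" if x: "(i, x, x) \<in> T" for i x
  proof -
    have "0 < card (D i x)"
      using x Dfin by (auto simp: D_def card_gt_0_iff)
    then have "0 < pos i x"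
      by (simp add: pos_def)
    moreover have "card (D i x) \<le> card X"
      using DX \<open>finite X\<close> card_mono by blast
    then have "pos i x < 1"
      by (simp add: pos_def)
    moreover define d where "d = a (i + 1) - a i"
    moreover have "0 < d"
      using gap(1) [OF ik [OF x]] by (simp add: d_def)
    ultimately have "0 < d * pos i x" "d * pos i x < d"
      by simp_all
    then show "a i < \<mu> x" "\<mu> x < a (i + 1)"
      unfolding \<mu>_val [OF x] val_def d_def [symmetric] by (simp_all add: d_def)
  qed
  have order: "\<mu> y \<le> \<mu> x \<longleftrightarrow> (i, x, y) \<in> T" if x: "(i, x, x) \<in> T" and y: "(i, y, y) \<in> T" for i x y
  proof -
    have "\<mu> y \<le> \<mu> x \<longleftrightarrow> card (D i y) \<le> card (D i x)"
      unfolding \<mu>_val [OF x] \<mu>_val [OF y] val_def pos_def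
      using gap(1) [OF ik [OF x]] by (simp add: divide_le_cancel)
    also have "\<dots> \<longleftrightarrow> (i, x, y) \<in> T"
    proof
      assume le: "card (D i y) \<le> card (D i x)"
      \<comment> \<open>Otherwise totality puts \<open>y\<close> strictly above \<open>x\<close>,
        and \<open>D i x\<close> is a part of \<open>D i y\<close> that lacks \<open>y\<close>,
        hence strictly smaller.\<close>
      show "(i, x, y) \<in> T"
      proof (rule ccontr)
        assume n: "(i, x, y) \<notin> T"
        then have "(i, y, x) \<in> T"
          using patterns_total [OF T x y] by blast
        then have "D i x \<subseteq> D i y"
          using patterns_trans [OF T, of i y x] by (auto simp: D_def)
        moreover have "y \<in> D i y" "y \<notin> D i x"
          using n y by (simp_all add: D_def)
        ultimately have "card (D i x) < card (D i y)"
          by (intro psubset_card_mono Dfin) blast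
        with le show False by simp
      qed
    next
      assume "(i, x, y) \<in> T"
      then have "D i y \<subseteq> D i x"
        using patterns_trans [OF T, of i x y] by (auto simp: D_def)
      then show "card (D i y) \<le> card (D i x)"
        using Dfin card_mono by blast
    qed
    finally show ?thesis .
  qed
  have reg: "\<exists>i\<le>k. (i, x, x) \<in> T \<and> a i < \<mu> x \<and> \<mu> x < a (i + 1) \<and> 0 < \<mu> x \<and> \<mu> x < 1"
    if x: "x \<in> ?Y" for x
  proof -
    obtain i where i: "(i, x, x) \<in> T"
      using patterns_ex [OF T x] by blast
    with bounds [OF i] gap [OF ik [OF i]] ik [OF i] show ?thesis
      by (intro exI [of _ i]) auto
  qed
  have "\<mu> x \<in> {0..1} - a ` {1..k}" if x: "x \<in> X" for x
  proof -
    have sp: "0 < a j" "a j < 1" if "1 \<le> j" "j \<le> k" for j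
      using spikes_less [OF a, of 0 j] spikes_less [OF a, of j "k + 1"] ends that by auto
    consider "\<mu> x = 0" | "\<mu> x = 1" | "x \<in> ?Y"
      using x by (cases "x \<in> Z"; cases "x \<in> B") (auto simp: \<mu>_def)
    then show ?thesis
    proof cases
      case 3
      then obtain i where i: "i \<le> k" "a i < \<mu> x" "\<mu> x < a (i + 1)" "0 < \<mu> x" "\<mu> x < 1"
        using reg by blast
      have "a j \<noteq> \<mu> x" if "j \<le> k" for j
        using i that spikes_le [OF a, of j i] spikes_le [OF a, of "i + 1" j]
        by (cases "j \<le> i") auto
      then have "\<mu> x \<notin> a ` {1..k}"
        by (metis atLeastAtMost_iff imageE)
      then show ?thesis
        using i by simp
    qed (use sp in \<open>force+\<close>)
  qed
  moreover have "\<mu> x = undefined" if "x \<notin> X" for x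
    using that Z B by (auto simp: \<mu>_def)
  ultimately have "\<mu> \<in> X \<rightarrow>\<^sub>E {0..1} - a ` {1..k}"
    by (intro PiE_I)
  moreover have "zeros X \<mu> = Z"
  proof -
    have "\<mu> x = 0 \<longleftrightarrow> x \<in> Z" if "x \<in> X" for x
      using reg [of x] that B by (cases "x \<in> ?Y") (auto simp: \<mu>_def)
    then show ?thesis
      using Z by (auto simp: zeros_def)
  qed
  moreover have "ones X \<mu> = B"
  proof -
    have "\<mu> x = 1 \<longleftrightarrow> x \<in> B" if "x \<in> X" for x
      using reg [of x] that B by (cases "x \<in> ?Y") (auto simp: \<mu>_def)
    then show ?thesis
      using B by (auto simp: ones_def)
  qed
  moreover have "pattern X k a \<mu> = T"
  proof -
    \<comment> \<open>A value inside interval \<open>i\<close> rules out \<open>Z\<close> and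
      \<open>B\<close>, so \<open>T\<close> places \<open>x\<close> in some interval
      \<open>j\<close> containing this value; disjointness of the intervals forces
      \<open>i = j\<close>.\<close>
    have in_T: "(i, x, x) \<in> T" if "x \<in> X" "i \<le> k" "a i < \<mu> x" "\<mu> x < a (i + 1)" for i x
    proof -
      have "0 < \<mu> x" "\<mu> x < 1"
        using that gap [of i] by auto
      then have "x \<in> ?Y"
        using that by (auto simp: \<mu>_def split: if_splits)
      then obtain j where j: "j \<le> k" "(j, x, x) \<in> T" "a j < \<mu> x" "\<mu> x < a (j + 1)"
        using reg by blast
      moreover have "i = j"
        using spikes_interval_unique [OF a, of i j "\<mu> x"] that j by blast
      ultimately show ?thesis by simp
    qed
    have "(i, x, y) \<in> pattern X k a \<mu> \<longleftrightarrow> (i, x, y) \<in> T" for i x y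
    proof
      assume p: "(i, x, y) \<in> pattern X k a \<mu>"
      then have "(i, x, x) \<in> T" "(i, y, y) \<in> T" "\<mu> y \<le> \<mu> x"
        by (auto simp: pattern_def intro!: in_T)
      then show "(i, x, y) \<in> T"
        using order by blast
    next
      assume t: "(i, x, y) \<in> T"
      then have "(i, x, x) \<in> T" "(i, y, y) \<in> T"
        using patterns_field [OF T] by auto
      then show "(i, x, y) \<in> pattern X k a \<mu>"
        using t bounds order ik xY by (auto simp: pattern_def)
    qed
    then show ?thesis by auto
  qed
  ultimately show ?thesis by blast
qed

section \<open>Number of classes and the final identity\<close>

text \<open>The invariants take every admissible value: disjoint zero and one sets and any pattern
  on the remaining points, by \<open>pattern_realized\<close>.\<close>

lemma card_fuzzy_classes_closed:
  assumes a: "spikes k a" and "finite X"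
  shows "card (fuzzy_classes X ({0..1} - a ` {1..k}) k a)
    = (\<Sum>Z\<in>Pow X. \<Sum>B\<in>Pow (X - Z). card (patterns (X - Z - B) k))"
proof -
  let ?c = "\<lambda>\<mu>. (zeros X \<mu>, ones X \<mu>, pattern X k a \<mu>)"
  have "?c ` (X \<rightarrow>\<^sub>E {0..1} - a ` {1..k})
      = (SIGMA Z:Pow X. SIGMA B:Pow (X - Z). patterns (X - Z - B) k)" (is "?L = ?R")
  proof
    show "?L \<subseteq> ?R"
      using pattern_in_patterns [OF a] by (auto simp: zeros_def ones_def)
    show "?R \<subseteq> ?L"
    proof clarify
      fix Z B T
      assume "Z \<subseteq> X" "B \<subseteq> X - Z" "T \<in> patterns (X - Z - B) k"
      from pattern_realized [OF a \<open>finite X\<close> this] show "(Z, B, T) \<in> ?L"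
        by force
    qed
  qed
  then show ?thesis
    using \<open>finite X\<close> finite_patterns [of "X - Z - B" k for Z B]
    by (simp add: card_fuzzy_classes [OF a] finite_SigmaI)
qed

text \<open>Excluding 0 and 1 amounts to empty zero and one sets, which leaves the pattern as the
  only invariant.\<close>

lemma card_fuzzy_classes_open:
  assumes a: "spikes k a" and "finite X"
  shows "card (fuzzy_classes X ({0<..<1} - a ` {1..k}) k a) = card (patterns X k)"
proof -
  let ?c = "\<lambda>\<mu>. (zeros X \<mu>, ones X \<mu>, pattern X k a \<mu>)"
  have maps: "X \<rightarrow>\<^sub>E {0<..<1} - a ` {1..k}
      = {\<mu> \<in> X \<rightarrow>\<^sub>E {0..1} - a ` {1..k}. zeros X \<mu> = {} \<and> ones X \<mu> = {}}"
    by (fastforce simp: PiE_iff zeros_def ones_def less_le)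
  have "?c ` (X \<rightarrow>\<^sub>E {0<..<1} - a ` {1..k}) = (\<lambda>T. ({}, {}, T)) ` patterns X k" (is "?L = ?R")
  proof
    show "?L \<subseteq> ?R"
      unfolding maps using pattern_in_patterns [OF a] by fastforce
    show "?R \<subseteq> ?L"
    proof clarify
      fix T assume "T \<in> patterns X k"
      then have "T \<in> patterns (X - {} - {}) k"
        by simp
      from pattern_realized [OF a \<open>finite X\<close> _ _ this] show "({}, {}, T) \<in> ?L"
        unfolding maps by force
    qed
  qed
  then show ?thesis
    by (simp add: card_fuzzy_classes [OF a] card_image inj_on_def)
qed

theorem theorem3p1:
  fixes X :: "nat \<Rightarrow> 'a set" and a :: "nat \<Rightarrow> nat \<Rightarrow> real" and n k :: nat
  assumes ground_sets: "\<And>m. finite (X m) \<and> card (X m) = m"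
    and spikes: "\<And>j. spikes j (a j)"
    and "n \<ge> 1" and "k \<ge> 1"
  shows "int (F2 X a n k) =
    4 * int (F0 X a n k) - 3 * int (F0 X a n (k - 1))
      - (\<Sum>i=1..n. int (n choose i) * int (F0 X a (n - i) (k - 1)))"
proof -
  obtain l where k: "k = Suc l"
    using \<open>k \<ge> 1\<close> by (cases k) auto
  have fin: "finite (X n)" and card: "card (X n) = n"
    using ground_sets by auto
  have F0: "F0 X a m j = card (patterns (X m) j)" for m j
    unfolding F0_def using ground_sets by (intro card_fuzzy_classes_open spikes) auto
  \<comment> \<open>Only the number of remaining points matters, so \<open>X (n - card Z)\<close>
    may replace \<open>X n - Z\<close>.\<close>
  have diff: "card (patterns (X n - Z) j) = F0 X a (n - card Z) j" if "Z \<in> Pow (X n)" for Z j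
    unfolding F0 using that fin card ground_sets
    by (intro card_patterns_cong) (auto simp: card_Diff_subset finite_subset)
  have "int (F2 X a n k)
      = (\<Sum>Z\<in>Pow (X n). \<Sum>B\<in>Pow (X n - Z). int (card (patterns (X n - Z - B) k)))"
    using card_fuzzy_classes_closed [OF spikes fin] by (simp add: F2_def)
  \<comment> \<open>The top block identity absorbs the one set, separately for each zero set
    \<open>Z\<close>.\<close>
  also have "\<dots> = (\<Sum>Z\<in>Pow (X n). 2 * int (card (patterns (X n - Z) k))
      - int (card (patterns (X n - Z) l)))"
    unfolding k using fin by (intro sum.cong refl sum_patterns_Diff) auto
  also have "\<dots> = 2 * (\<Sum>Z\<in>Pow (X n). int (card (patterns (X n - Z) k)))
      - (\<Sum>Z\<in>Pow (X n). int (card (patterns (X n - Z) l)))"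
    by (simp add: sum_subtractf sum_distrib_left)
  also have "(\<Sum>Z\<in>Pow (X n). int (card (patterns (X n - Z) k)))
      = 2 * int (F0 X a n k) - int (F0 X a n l)"
    unfolding F0 k by (rule sum_patterns_Diff [OF fin])
  \<comment> \<open>At level \<open>l\<close>, which may be 0, the identity for successors does not
    apply; the zero sets are grouped by size instead.\<close>
  also have "(\<Sum>Z\<in>Pow (X n). int (card (patterns (X n - Z) l)))
      = (\<Sum>i=0..n. int (n choose i) * int (F0 X a (n - i) l))"
    using sum_Pow_card [OF fin, of "\<lambda>i. int (F0 X a (n - i) l)"] by (simp add: diff card)
  \<comment> \<open>The empty zero set yields a third copy of \<open>F0 X a n l\<close>, the other
    two coming from the doubled sum at level \<open>k\<close>; hence the coefficient 3.\<close>
  also have "\<dots> = int (F0 X a n l) + (\<Sum>i=1..n. int (n choose i) * int (F0 X a (n - i) l))"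
    by (simp add: sum.atLeast_Suc_atMost)
  finally show ?thesis
    by (simp add: k)
qed

end
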